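(* Let $G$ be a finite simple graph with vertex set $V=\{v_1,\dots,v_n\}$ and edge set $E$, and let $\mathbb{k}=GF(2)$. Then $N_{\mathbb{k}}(G)=1$ if and only if $G$ is covered by length $2$ paths.
   Context: Bayer's formulation of 3-colorability of $G$ over a field $\mathbb{k}$ is the polynomial system in $\mathbb{k}[x_1,\dots,x_n]$ consisting of $x_i^3-1=0$ for every vertex $v_i\in V$ and $x_i^2+x_ix_j+x_j^2=0$ for every edge $v_iv_j\in E$; when $\mathrm{char}(\mathbb{k})\neq 3$, $G$ is 3-colorable if and only if this system has a solution over the algebraic closure $\overline{\mathbb{k}}$. A Nullstellensatz certificate of infeasibility for a system $f_1=\dots=f_s=0$ is a tuple of polynomials $\alpha_1,\dots,\alpha_s\in\mathbb{k}[x_1,\dots,x_n]$ with $1=\alpha_1f_1+\dots+\alpha_sf_s$; its degree is $\max_i\deg\alpha_i$. $N_{\mathbb{k}}(G)$ denotes the minimum degree of a Nullstellensatz certificate of infeasibility for Bayer's formulation of $G$ over $\mathbb{k}$ (such certificates exist exactly when $G$ is not 3-colorable; for 3-colorable $G$, $N_{\mathbb{k}}(G)$ is undefined, i.e. not equal to any integer). A length $2$ path $v_iv_jv_k$ in $G$ consists of distinct vertices with $v_iv_j,v_jv_k\in E$; $v_j$ is its middle vertex and $v_i,v_k$ its endpoints. $G$ is \emph{covered by length 2 paths} if there exists a set $C$ of length $2$ paths in $G$ such that: (1) each edge in $E$ appears in an even number of paths in $C$; (2) the number of paths $v_iv_jv_k$ in $C$ with $j<i,k$ or $j>i,k$ is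 odd; (3) whenever $v_i,v_j\in V$ with $v_iv_j\notin E$, the number of paths in $C$ having $v_i$ and $v_j$ as endpoints is even. *)

theory Defs
  imports
    Complex_Main
    "HOL-Library.Poly_Mapping"
    "HOL-Library.Z2"
    "HOL-Library.Extended_Nat"
begin

text \<open>
  Multivariate polynomials are finitely supported maps from monomials to coefficients, where a
  monomial is a finitely supported map from variable indices to exponents; multiplication on
  \<^typ>\<open>'a \<Rightarrow>\<^sub>0 'b\<close> is convolution.
\<close>

type_synonym 'k mpoly = "(nat \<Rightarrow>\<^sub>0 nat) \<Rightarrow>\<^sub>0 'k"

definition mvar :: "nat \<Rightarrow> 'k::field mpoly" where
  "mvar i = Poly_Mapping.single (Poly_Mapping.single i 1) 1"

text \<open>The polynomial ring in the variables with indices \<open>1, \<dots>, n\<close>.\<close>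

definition mpoly_ring :: "nat \<Rightarrow> 'k::field mpoly set" where
  "mpoly_ring n = {p. \<forall>m \<in> Poly_Mapping.keys p. Poly_Mapping.keys m \<subseteq> {1..n}}"

text \<open>
  The total degree, with the zero polynomial given degree 0. This convention does not affect the
  degree of a certificate: some coefficient of a certificate is nonzero.
\<close>

definition monom_degree :: "(nat \<Rightarrow>\<^sub>0 nat) \<Rightarrow> nat" where
  "monom_degree m = (\<Sum>i \<in> Poly_Mapping.keys m. Poly_Mapping.lookup m i)"

definition total_degree :: "'k::field mpoly \<Rightarrow> nat" where
  "total_degree p = Max (insert 0 (monom_degree ` Poly_Mapping.keys p))"

text \<open>
  A system of equations is a finite set \<open>F\<close> of polynomials, and the tuple of coefficients of a
  certificate is a family \<open>\<alpha>\<close> indexed by \<open>F\<close>; values of \<open>\<alpha>\<close> outside \<open>F\<close> are irrelevant.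
\<close>

definition nullstellensatz_certificate ::
    "nat \<Rightarrow> 'k::field mpoly set \<Rightarrow> ('k mpoly \<Rightarrow> 'k mpoly) \<Rightarrow> bool" where
  "nullstellensatz_certificate n F \<alpha> \<longleftrightarrow>
     (\<forall>f \<in> F. \<alpha> f \<in> mpoly_ring n) \<and> 1 = (\<Sum>f \<in> F. \<alpha> f * f)"

definition certificate_degree ::
    "'k::field mpoly set \<Rightarrow> ('k mpoly \<Rightarrow> 'k mpoly) \<Rightarrow> nat" where
  "certificate_degree F \<alpha> = Max ((\<lambda>f. total_degree (\<alpha> f)) ` F)"

text \<open>
  Graphs have vertices \<open>v\<^sub>1, \<dots>, v\<^sub>n\<close>, where \<open>v\<^sub>i\<close> is identified with \<open>i\<close>, and edges are
  two-element sets of vertices.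
\<close>

definition simple_graph :: "nat \<Rightarrow> nat set set \<Rightarrow> bool" where
  "simple_graph n E \<longleftrightarrow> E \<subseteq> {{i, j} | i j. i \<in> {1..n} \<and> j \<in> {1..n} \<and> i \<noteq> j}"

definition bayer_system :: "nat \<Rightarrow> nat set set \<Rightarrow> 'k::field mpoly set" where
  "bayer_system n E =
     {mvar i ^ 3 - 1 | i. i \<in> {1..n}} \<union>
     {mvar i ^ 2 + mvar i * mvar j + mvar j ^ 2 | i j. {i, j} \<in> E}"

text \<open>
  The minimum degree of a certificate; the infimum of the empty set is \<open>\<infinity>\<close>, which stands for
  the undefined value. The first argument selects the field.
\<close>

definition nullstellensatz_number :: "'k::field itself \<Rightarrow> nat \<Rightarrow> nat set set \<Rightarrow> enat" where
  "nullstellensatz_number _ n E =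
     Inf {enat (certificate_degree (bayer_system n E) \<alpha>) | \<alpha> :: 'k mpoly \<Rightarrow> 'k mpoly.
            nullstellensatz_certificate n (bayer_system n E) \<alpha>}"

text \<open>
  A path \<open>v\<^sub>i v\<^sub>j v\<^sub>k\<close> is the pair of its middle vertex \<open>j\<close> and its set of endpoints \<open>{i, k}\<close>,
  so that \<open>v\<^sub>i v\<^sub>j v\<^sub>k\<close> and \<open>v\<^sub>k v\<^sub>j v\<^sub>i\<close> are the same path.
\<close>

type_synonym path2 = "nat \<times> nat set"

definition length2_paths :: "nat set set \<Rightarrow> path2 set" where
  "length2_paths E =
     {(j, {i, k}) | i j k. i \<noteq> j \<and> j \<noteq> k \<and> i \<noteq> k \<and> {i, j} \<in> E \<and> {j, k} \<in> E}"

definition middle :: "path2 \<Rightarrow> nat" where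
  "middle p = fst p"

definition endpoints :: "path2 \<Rightarrow> nat set" where
  "endpoints p = snd p"

definition path_edges :: "path2 \<Rightarrow> nat set set" where
  "path_edges p = {{i, middle p} | i. i \<in> endpoints p}"

definition covered_by_length2_paths :: "nat \<Rightarrow> nat set set \<Rightarrow> bool" where
  "covered_by_length2_paths n E \<longleftrightarrow>
     (\<exists>C \<subseteq> length2_paths E.
        (\<forall>e \<in> E. even (card {p \<in> C. e \<in> path_edges p})) \<and>
        odd (card {p \<in> C. (\<forall>i \<in> endpoints p. middle p < i) \<or> (\<forall>i \<in> endpoints p. middle p > i)}) \<and>
        (\<forall>i \<in> {1..n}. \<forall>j \<in> {1..n}. {i, j} \<notin> E \<longrightarrow> even (card {p \<in> C. endpoints p = {i, j}})))"

end

theory Submission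
  imports Defs "HOL-Library.Multiset"
begin

text \<open>
  Write \<open>f\<^sub>e\<close> for the polynomial of an edge. Over \<open>GF(2)\<close> only the constant term and the cubic part of a
  degree 1 certificate carry information: they amount to an odd set \<open>A\<close> of vertices and a set \<open>B\<close> of
  pairs (edge, vertex) with \<open>\<Sum>i\<in>A. x\<^sub>i\<^sup>3 = \<Sum>(e, k)\<in>B. x\<^sub>k f\<^sub>e\<close>. Comparing coefficients of \<open>x\<^sub>i x\<^sub>j x\<^sub>k\<close>
  for distinct \<open>i, j, k\<close>, an even number of the pairs \<open>(ij, k), (jk, i), (ik, j)\<close> lies in \<open>B\<close>, so the
  pairs with \<open>k \<notin> e\<close> are grouped in twos, that is, by paths \<open>v\<^sub>i v\<^sub>j v\<^sub>k\<close>, with contributions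
  \<open>x\<^sub>k f\<^sub>i\<^sub>j + x\<^sub>i f\<^sub>j\<^sub>k = (x\<^sub>i\<^sup>2 x\<^sub>k + x\<^sub>i x\<^sub>k\<^sup>2) + x\<^sub>j\<^sup>2 x\<^sub>i + x\<^sub>j\<^sup>2 x\<^sub>k\<close>.
  The coefficients of \<open>x\<^sub>u\<^sup>2 x\<^sub>v\<close> then give conditions (1) and (3), and the sum of all coefficients of
  \<open>x\<^sub>i\<^sup>3\<close> and of \<open>x\<^sub>i\<^sup>2 x\<^sub>j\<close> with \<open>i < j\<close>, \<open>v\<^sub>i v\<^sub>j \<in> E\<close>, gives (2), because it kills \<open>x\<^sub>k f\<^sub>e\<close> for \<open>k \<in> e\<close>.
  Conversely, \<open>x\<^sub>i\<^sup>2 x\<^sub>j + x\<^sub>i x\<^sub>j\<^sup>2 + 1 = x\<^sub>i f\<^sub>i\<^sub>j + (x\<^sub>i\<^sup>3 - 1)\<close> for every edge, so modulo the combinations with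
  coefficients of degree at most 1 the sum of the path polynomials over a cover is 1.
\<close>

section \<open>Arithmetic in characteristic 2\<close>

declare add_bit_eq_xor [simp del] mult_bit_eq_and [simp del]

text \<open>With the rewriting of \<open>+\<close> to \<open>xor\<close> switched off, sums over
  \<open>bit\<close> stay in ring form and equal terms cancel by these rules.\<close>

lemma add_self_bit [simp]: "(a::bit) + a = 0"
  by (cases a) simp_all

lemma add_self_left_bit [simp]: "(a::bit) + (a + b) = b"
  by (simp flip: add.assoc)

lemma add_self_mpoly [simp]: "(p :: bit mpoly) + p = 0"
  by (rule poly_mapping_eqI) (simp only: lookup_add add_self_bit lookup_zero)

lemma two_mpoly [simp]: "(2 :: bit mpoly) = 0"
  by (simp only: add_self_mpoly flip: one_add_one)

lemma diff_mpoly_bit: "(p :: bit mpoly) - q = p + q"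
  by (simp add: diff_eq_eq add.assoc)

lemma of_nat_bit: "(of_nat n :: bit) = of_bool (odd n)"
  by (induction n) auto

lemma of_nat_mpoly_bit: "(of_nat n :: bit mpoly) = of_bool (odd n)"
  by (induction n) auto

lemma sum_of_bool_bit:
  "finite A \<Longrightarrow> (\<Sum>x\<in>A. of_bool (P x) :: bit) = of_bool (odd (card {x \<in> A. P x}))"
  by (simp add: of_nat_bit Collect_conj_eq)

lemma of_bool_disj_bit: "\<not> (P \<and> Q) \<Longrightarrow> (of_bool (P \<or> Q) :: bit) = of_bool P + of_bool Q"
  by auto

text \<open>Collect the terms by the value of \<open>\<phi>\<close>: the fibre over \<open>y\<close>
  contributes its size times \<open>h y\<close>, and only the parity of the size survives. Both the
  grouping of pairs into paths and the cancellations over a cover rest on this.\<close>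

lemma sum_odd_fibers:
  fixes h :: "'b \<Rightarrow> bit mpoly"
  assumes "finite X"
  shows "(\<Sum>x\<in>X. h (\<phi> x)) = (\<Sum>y | odd (card {x \<in> X. \<phi> x = y}). h y)"
proof -
  have "(\<Sum>x\<in>X. h (\<phi> x)) = (\<Sum>y\<in>\<phi> ` X. \<Sum>x | x \<in> X \<and> \<phi> x = y. h (\<phi> x))"
    using assms by (rule sum.image_gen)
  also have "\<dots> = (\<Sum>y\<in>\<phi> ` X. of_nat (card {x \<in> X. \<phi> x = y}) * h y)"
    by (intro sum.cong refl) simp
  also have "\<dots> = (\<Sum>y\<in>\<phi> ` X. if odd (card {x \<in> X. \<phi> x = y}) then h y else 0)"
    by (intro sum.cong refl) (simp add: of_nat_mpoly_bit)
  also have "\<dots> = (\<Sum>y | odd (card {x \<in> X. \<phi> x = y}). h y)"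
  proof -
    \<comment> \<open>An odd fibre is nonempty, so the index set on the right lies in the finite
      image of \<open>X\<close>.\<close>
    have "y \<in> \<phi> ` X" if "odd (card {x \<in> X. \<phi> x = y})" for y
    proof -
      from that have "{x \<in> X. \<phi> x = y} \<noteq> {}" by force
      then show ?thesis by auto
    qed
    then have "{y. odd (card {x \<in> X. \<phi> x = y})} = \<phi> ` X \<inter> {y. odd (card {x \<in> X. \<phi> x = y})}"
      by auto
    then show ?thesis using assms by (simp add: sum.If_cases)
  qed
  finally show ?thesis .
qed

section \<open>Monomials and coefficients\<close>

text \<open>Monomials are named by multisets of variable indices, so that equality of monomials is decided by
  the multiset simplifier.\<close>

definition expo :: "nat multiset \<Rightarrow> (nat \<Rightarrow>\<^sub>0 nat)" where
  "expo M = (\<Sum>i\<in>#M. Poly_Mapping.single i 1)"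

definition mon :: "nat multiset \<Rightarrow> bit mpoly" where
  "mon M = Poly_Mapping.single (expo M) 1"

definition coef :: "bit mpoly \<Rightarrow> nat multiset \<Rightarrow> bit" where
  "coef p M = Poly_Mapping.lookup p (expo M)"

lemma lookup_expo: "Poly_Mapping.lookup (expo M) i = count M i"
  by (induction M) (auto simp: expo_def lookup_add lookup_single when_def)

lemma expo_eq_iff [simp]: "expo M = expo N \<longleftrightarrow> M = N"
  by (metis lookup_expo multiset_eqI)

lemma coef_mon: "coef (mon M) N = of_bool (M = N)"
  by (simp add: coef_def mon_def lookup_single when_def)

lemma coef_add: "coef (p + q) M = coef p M + coef q M"
  by (simp add: coef_def lookup_add)

lemma coef_sum: "coef (\<Sum>x\<in>X. f x) M = (\<Sum>x\<in>X. coef (f x) M)"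
  by (simp add: coef_def lookup_sum)

lemma coef_0 [simp]: "coef 0 M = 0"
  by (simp add: coef_def)

lemma mon_times: "mon M * mon N = mon (M + N)"
  by (simp add: mon_def mult_single expo_def)

lemma mon_empty: "mon {#} = 1"
  by (simp add: mon_def expo_def)

lemma mvar_mon: "mvar i = mon {#i#}"
  by (simp add: mvar_def mon_def expo_def)

lemma keys_expo: "Poly_Mapping.keys (expo M) = set_mset M"
  by (auto simp: in_keys_iff lookup_expo)

lemma monom_degree_expo: "monom_degree (expo M) = size M"
  by (simp add: monom_degree_def keys_expo lookup_expo size_multiset_overloaded_eq)

text \<open>An exponent map has finite support, which is what makes it the multiplicity function of
  a multiset. Hence polynomials may be compared through \<open>coef\<close> alone.\<close>

lemma expo_surj: "\<exists>M. m = expo M"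
proof
  show "m = expo (Abs_multiset (Poly_Mapping.lookup m))"
    by (rule poly_mapping_eqI) (simp add: lookup_expo Abs_multiset_inverse)
qed

lemma mpoly_eqI: "(\<And>M. coef p M = coef q M) \<Longrightarrow> p = q"
  by (metis coef_def expo_surj poly_mapping_eqI)

section \<open>Polynomials of degree at most 1\<close>

definition lin :: "nat \<Rightarrow> bit mpoly set" where
  "lin n = {p \<in> mpoly_ring n. total_degree p \<le> 1}"

lemma total_degree_le_iff: "total_degree p \<le> d \<longleftrightarrow> (\<forall>m\<in>Poly_Mapping.keys p. monom_degree m \<le> d)"
  by (auto simp: total_degree_def)

text \<open>Ring membership and the degree bound become one condition on multisets; over
  \<open>bit\<close> a nonzero coefficient is one equal to 1.\<close>

lemma lin_iff: "p \<in> lin n \<longleftrightarrow> (\<forall>M. coef p M = 1 \<longrightarrow> set_mset M \<subseteq> {1..n} \<and> size M \<le> 1)"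
proof -
  have "(\<forall>m\<in>Poly_Mapping.keys p. Q m) \<longleftrightarrow> (\<forall>M. coef p M = 1 \<longrightarrow> Q (expo M))" for Q
  proof (intro iffI allI ballI impI)
    fix m assume *: "\<forall>M. coef p M = 1 \<longrightarrow> Q (expo M)" and m: "m \<in> Poly_Mapping.keys p"
    obtain M where "m = expo M" using expo_surj by blast
    then show "Q m" using * m by (auto simp: coef_def in_keys_iff)
  qed (auto simp: coef_def in_keys_iff)
  then show ?thesis
    by (auto simp: lin_def mpoly_ring_def total_degree_le_iff keys_expo monom_degree_expo)
qed

text \<open>All coefficients are 0 or 1, so one truth value and a set of variables determine such a
  polynomial. This is how a certificate turns into sets.\<close>

lemma lin_expand:
  assumes "p \<in> lin n"
  shows "p = of_bool (coef p {#} = 1) + (\<Sum>k | k \<in> {1..n} \<and> coef p {#k#} = 1. mon {#k#})"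
proof (rule mpoly_eqI)
  fix M
  show "coef p M =
    coef (of_bool (coef p {#} = 1) + (\<Sum>k | k \<in> {1..n} \<and> coef p {#k#} = 1. mon {#k#})) M"
  proof (cases "size M \<le> 1")
    case False
    then have "coef p M = 0" "\<And>k. {#k#} \<noteq> M" "{#} \<noteq> M"
      using assms by (force simp: lin_iff)+
    then show ?thesis
      by (simp add: coef_add coef_sum coef_mon of_bool_def flip: mon_empty)
  next
    case True
    then consider "M = {#}" | k where "M = {#k#}"
      by (metis One_nat_def le_0_eq le_Suc_eq size_1_singleton_mset size_eq_0_iff_empty)
    then show ?thesis
    proof cases
      case 1
      then show ?thesis
        by (cases "coef p {#}") (auto simp: coef_add coef_sum coef_mon simp flip: mon_empty)
    next
      case (2 k)
      have "coef (of_bool (coef p {#} = 1)) M = 0"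
        using 2 by (simp add: coef_mon of_bool_def flip: mon_empty)
      moreover have "(\<Sum>x | x \<in> {1..n} \<and> coef p {#x#} = 1. of_bool (x = k) :: bit)
         = of_bool (k \<in> {1..n} \<and> coef p {#k#} = 1)"
        by (simp add: of_bool_def)
      moreover have "k \<in> {1..n}" if "coef p {#k#} = 1"
        using assms that by (force simp: lin_iff)
      ultimately show ?thesis
        using 2 by (cases "coef p {#k#}") (auto simp: coef_add coef_sum coef_mon)
    qed
  qed
qed

lemma lin_add: "p \<in> lin n \<Longrightarrow> q \<in> lin n \<Longrightarrow> p + q \<in> lin n"
  unfolding lin_iff coef_add
proof (intro allI impI)
  fix M
  assume "\<forall>M. coef p M = 1 \<longrightarrow> set_mset M \<subseteq> {1..n} \<and> size M \<le> 1"
    "\<forall>M. coef q M = 1 \<longrightarrow> set_mset M \<subseteq> {1..n} \<and> size M \<le> 1"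
    "coef p M + coef q M = 1"
  then show "set_mset M \<subseteq> {1..n} \<and> size M \<le> 1"
    by (cases "coef p M") auto
qed

lemma lin_0: "0 \<in> lin n"
  by (simp add: lin_iff)

lemma lin_1: "1 \<in> lin n"
  by (auto simp: lin_iff coef_mon simp flip: mon_empty)

lemma lin_mon: "k \<in> {1..n} \<Longrightarrow> mon {#k#} \<in> lin n"
  by (auto simp: lin_iff coef_mon)

section \<open>The polynomials of Bayer's system over GF(2)\<close>

text \<open>Indexed by the unordered edge, so that each edge has one polynomial;
  \<open>mset_set e\<close> is the product of its two variables.\<close>

definition edge_poly :: "nat set \<Rightarrow> bit mpoly" where
  "edge_poly e = mon (mset_set e) + (\<Sum>i\<in>e. mon {#i, i#})"

text \<open>The constant is written 1 because -1 = 1 in characteristic 2.\<close>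

definition vertex_poly :: "nat \<Rightarrow> bit mpoly" where
  "vertex_poly i = mon {#i, i, i#} + 1"

lemma edge_poly_pair: "i \<noteq> j \<Longrightarrow> edge_poly {i, j} = mon {#i, i#} + mon {#i, j#} + mon {#j, j#}"
  by (simp add: edge_poly_def add_ac)

lemma simple_graphD:
  assumes "simple_graph n E" "{i, j} \<in> E"
  shows "i \<noteq> j" "i \<in> {1..n}" "j \<in> {1..n}"
  using assms by (auto simp: simple_graph_def doubleton_eq_iff dest!: subsetD)

lemma simple_graphE:
  assumes "simple_graph n E" "e \<in> E"
  obtains i j where "e = {i, j}" "i \<noteq> j" "i \<in> {1..n}" "j \<in> {1..n}"
  using assms by (auto simp: simple_graph_def)

lemma simple_graph_finite: "simple_graph n E \<Longrightarrow> finite E"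
  by (rule finite_subset[of _ "Pow {1..n}"]) (auto simp: simple_graph_def)

lemma bayer_system_eq:
  assumes "simple_graph n E"
  shows "bayer_system n E = vertex_poly ` {1..n} \<union> edge_poly ` E"
proof -
  have v: "mvar i ^ 3 - 1 = vertex_poly i" for i
    by (simp add: vertex_poly_def diff_mpoly_bit mvar_mon power3_eq_cube mon_times)
  have e: "mvar i ^ 2 + mvar i * mvar j + mvar j ^ 2 = edge_poly {i, j}" if "{i, j} \<in> E" for i j
    using simple_graphD[OF assms that]
    by (simp add: edge_poly_pair mvar_mon power2_eq_square mon_times add_mset_commute)
  have "{mvar i ^ 2 + mvar i * mvar j + mvar j ^ 2 | i j. {i, j} \<in> E} = edge_poly ` E"
  proof (intro subset_antisym subsetI)
    fix p assume "p \<in> edge_poly ` E"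
    then obtain e where "e \<in> E" "p = edge_poly e" by blast
    moreover obtain i j where "e = {i, j}" using assms \<open>e \<in> E\<close> by (rule simple_graphE)
    ultimately show "p \<in> {mvar i ^ 2 + mvar i * mvar j + mvar j ^ 2 | i j. {i, j} \<in> E}"
      using e[of i j] by (metis (mono_tags, lifting) mem_Collect_eq)
  qed (use e in auto)
  then show ?thesis
    by (simp add: bayer_system_def v image_def Bex_def conj_commute)
qed

text \<open>Multiplicities tell the squared variable from the other one. No distinctness is assumed,
  so cubes are covered as well.\<close>

lemma mset_square_eq_iff: "{#a, a, b#} = {#u, u, v#} \<longleftrightarrow> a = u \<and> b = v"
proof
  assume eq: "{#a, a, b#} = {#u, u, v#}"
  have "count {#a, a, b#} a = count {#u, u, v#} a" "count {#a, a, b#} b = count {#u, u, v#} b"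
    "count {#a, a, b#} u = count {#u, u, v#} u"
    by (simp_all only: eq)
  then show "a = u \<and> b = v" by (simp split: if_splits)
qed simp

lemma coef_vertex_poly:
  "coef (vertex_poly i) {#} = 1" "coef (vertex_poly i) {#j, j, j#} = of_bool (i = j)"
  by (simp_all add: vertex_poly_def coef_add coef_mon mset_square_eq_iff flip: mon_empty)

lemma mset_pair_eq_iff: "{#i, j#} = {#u, v#} \<longleftrightarrow> {i, j} = {u, v}" if "i \<noteq> j" "u \<noteq> v"
proof
  show "{i, j} = {u, v}" if "{#i, j#} = {#u, v#}"
    using arg_cong[OF that, of set_mset] by simp
  show "{#i, j#} = {#u, v#}" if "{i, j} = {u, v}"
    using arg_cong[OF that, of mset_set] \<open>i \<noteq> j\<close> \<open>u \<noteq> v\<close> by simp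
qed

text \<open>The vanishing constant term separates edge from vertex polynomials, and the mixed
  monomial identifies the edge. So sums over the system become sums over vertices and over
  edges.\<close>

lemma coef_edge_poly:
  assumes "e = {i, j}" "i \<noteq> j"
  shows "coef (edge_poly e) {#} = 0" "u \<noteq> v \<Longrightarrow> coef (edge_poly e) {#u, v#} = of_bool (e = {u, v})"
proof -
  show "coef (edge_poly e) {#} = 0"
    using assms by (simp add: edge_poly_pair coef_add coef_mon)
  assume uv: "u \<noteq> v"
  have "{#l, l#} \<noteq> {#u, v#}" for l
  proof
    assume "{#l, l#} = {#u, v#}"
    from arg_cong[OF this, of set_mset] show False using uv by auto
  qed
  then show "coef (edge_poly e) {#u, v#} = of_bool (e = {u, v})"
    unfolding assms(1) edge_poly_pair[OF assms(2)] coef_add coef_mon mset_pair_eq_iff[OF assms(2) uv]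
    by simp
qed

lemma inj_vertex_poly: "inj vertex_poly"
  by (rule injI) (metis coef_vertex_poly(2) of_bool_eq_iff)

lemma inj_edge_poly:
  assumes "simple_graph n E"
  shows "inj_on edge_poly E"
proof (rule inj_onI)
  fix e f assume *: "e \<in> E" "f \<in> E" "edge_poly e = edge_poly f"
  obtain i j where e: "e = {i, j}" "i \<noteq> j" using assms *(1) by (rule simple_graphE)
  obtain k l where f: "f = {k, l}" "k \<noteq> l" using assms *(2) by (rule simple_graphE)
  from coef_edge_poly(2)[OF e e(2)] coef_edge_poly(2)[OF f e(2)] *(3) e show "e = f"
    by (metis of_bool_eq_iff)
qed

lemma vertex_poly_edge_poly_disjoint:
  assumes "simple_graph n E"
  shows "vertex_poly ` V \<inter> edge_poly ` E = {}"
proof -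
  have "vertex_poly i \<noteq> edge_poly e" if "e \<in> E" for i e
    using assms that by (metis coef_vertex_poly(1) coef_edge_poly(1) simple_graphE zero_neq_one)
  then show ?thesis by auto
qed

section \<open>The cubic part of a degree 1 certificate\<close>

lemma coef_mon_size: "size M \<noteq> size N \<Longrightarrow> coef (mon M) N = 0"
  by (auto simp: coef_mon)

lemma mon_edge_poly:
  "i \<noteq> j \<Longrightarrow> mon {#k#} * edge_poly {i, j} = mon {#i, i, k#} + mon {#j, j, k#} + mon {#i, j, k#}"
  by (simp add: edge_poly_pair mon_times distrib_left add_mset_commute add_ac)

text \<open>\<open>A\<close> collects the vertices whose coefficient has constant term 1, and
  \<open>B\<close> the pairs \<open>(e, k)\<close> for which x_k occurs in the coefficient of the
  edge polynomial of \<open>e\<close>. Constant terms give the parity of \<open>A\<close>, terms of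
  degree 3 the identity. The last conclusion serves to exclude certificates of degree 0.\<close>

lemma linear_certificateE:
  assumes sg: "simple_graph n E"
    and cert: "nullstellensatz_certificate n (bayer_system n E) \<alpha>"
    and lin: "\<forall>f\<in>bayer_system n E. \<alpha> f \<in> lin n"
  obtains A B where "A \<subseteq> {1..n}" "odd (card A)" "B \<subseteq> E \<times> {1..n}"
    "\<forall>M. size M = 3 \<longrightarrow>
       coef ((\<Sum>i\<in>A. mon {#i, i, i#}) + (\<Sum>(e, k)\<in>B. mon {#k#} * edge_poly e)) M = 0"
    "\<forall>(e, k)\<in>B. \<exists>f\<in>bayer_system n E. coef (\<alpha> f) {#k#} = 1"
proof -
  define c where "c f \<longleftrightarrow> coef (\<alpha> f) {#} = 1" for f
  define K where "K f = {k. k \<in> {1..n} \<and> coef (\<alpha> f) {#k#} = 1}" for f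
  define A where "A = {i \<in> {1..n}. c (vertex_poly i)}"
  define B where "B = Sigma E (\<lambda>e. K (edge_poly e))"
  have fE: "finite E" using sg by (rule simple_graph_finite)
  have fK: "finite (K f)" for f by (simp add: K_def)
  have F: "bayer_system n E = vertex_poly ` {1..n} \<union> edge_poly ` E"
    using sg by (rule bayer_system_eq)
  have \<alpha>: "\<alpha> f * f = of_bool (c f) * f + (\<Sum>k\<in>K f. mon {#k#} * f)" if "f \<in> bayer_system n E" for f
  proof -
    have "\<alpha> f = of_bool (c f) + (\<Sum>k\<in>K f. mon {#k#})"
      unfolding c_def K_def by (rule lin_expand[OF lin[rule_format, OF that]])
    then have "\<alpha> f * f = (of_bool (c f) + (\<Sum>k\<in>K f. mon {#k#})) * f" by simp
    then show ?thesis by (simp only: distrib_right sum_distrib_right)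
  qed
  have "1 = (\<Sum>f\<in>bayer_system n E. \<alpha> f * f)"
    using cert by (simp add: nullstellensatz_certificate_def)
  also have "\<dots> = (\<Sum>f\<in>vertex_poly ` {1..n}. \<alpha> f * f) + (\<Sum>f\<in>edge_poly ` E. \<alpha> f * f)"
    unfolding F using fE vertex_poly_edge_poly_disjoint[OF sg] by (intro sum.union_disjoint) auto
  also have "(\<Sum>f\<in>vertex_poly ` {1..n}. \<alpha> f * f) = (\<Sum>i=1..n. \<alpha> (vertex_poly i) * vertex_poly i)"
    by (simp add: sum.reindex inj_on_subset[OF inj_vertex_poly])
  also have "(\<Sum>f\<in>edge_poly ` E. \<alpha> f * f) = (\<Sum>e\<in>E. \<alpha> (edge_poly e) * edge_poly e)"
    by (simp add: sum.reindex inj_edge_poly[OF sg])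
  finally have eq: "1 = (\<Sum>i=1..n. \<alpha> (vertex_poly i) * vertex_poly i) + (\<Sum>e\<in>E. \<alpha> (edge_poly e) * edge_poly e)" .
  have one: "coef 1 M = (\<Sum>i=1..n. coef (\<alpha> (vertex_poly i) * vertex_poly i) M) +
      (\<Sum>e\<in>E. coef (\<alpha> (edge_poly e) * edge_poly e) M)" for M
    by (subst eq) (simp only: coef_add coef_sum)
  have v0: "coef (\<alpha> (vertex_poly i) * vertex_poly i) {#} = of_bool (c (vertex_poly i))" if "i \<in> {1..n}" for i
  proof -
    have "coef (mon {#k#} * vertex_poly i) {#} = 0" for k
      by (simp add: vertex_poly_def distrib_left mon_times coef_add coef_mon)
    then show ?thesis
      using that by (simp add: \<alpha> F coef_add coef_sum coef_vertex_poly of_bool_def)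
  qed
  \<comment> \<open>The terms of x_k (x_i^3 + 1) have degrees 4 and 1, so a cubic term comes only
    from the constant part of the coefficient.\<close>
  have v3: "coef (\<alpha> (vertex_poly i) * vertex_poly i) M = of_bool (c (vertex_poly i)) * coef (mon {#i, i, i#}) M"
    if "i \<in> {1..n}" "size M = 3" for i M
  proof -
    have "coef (mon {#k#} * vertex_poly i) M = 0" for k
      using that by (simp add: vertex_poly_def distrib_left mon_times coef_add coef_mon_size)
    moreover have "coef (vertex_poly i) M = coef (mon {#i, i, i#}) M"
      using that by (simp add: vertex_poly_def coef_add coef_mon_size flip: mon_empty)
    ultimately show ?thesis
      using that by (simp add: \<alpha> F coef_add coef_sum of_bool_def)
  qed
  have e0: "coef (\<alpha> (edge_poly e) * edge_poly e) {#} = 0" if e: "e \<in> E" for e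
  proof -
    obtain i j where ij: "e = {i, j}" "i \<noteq> j" using sg e by (rule simple_graphE)
    then show ?thesis
      using e by (simp add: \<alpha> F coef_add coef_sum of_bool_def coef_edge_poly(1) mon_edge_poly coef_mon_size)
  qed
  \<comment> \<open>Constant multiples of an edge polynomial are quadratic and disappear in degree
    3.\<close>
  have e3: "coef (\<alpha> (edge_poly e) * edge_poly e) M = (\<Sum>k\<in>K (edge_poly e). coef (mon {#k#} * edge_poly e) M)"
    if e: "e \<in> E" "size M = 3" for e M
  proof -
    obtain i j where ij: "e = {i, j}" "i \<noteq> j" using sg e(1) by (rule simple_graphE)
    then have "coef (edge_poly e) M = 0"
      using e(2) by (simp add: edge_poly_pair coef_add coef_mon_size)
    then show ?thesis
      using e by (simp add: \<alpha> F coef_add coef_sum of_bool_def)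
  qed
  show thesis
  proof
    show "A \<subseteq> {1..n}" by (auto simp: A_def)
    \<comment> \<open>The constant term of the certificate identity counts \<open>A\<close> modulo
      2.\<close>
    have "coef 1 {#} = (\<Sum>i=1..n. of_bool (c (vertex_poly i)) :: bit)"
      using one[of "{#}"] by (simp add: v0 e0 del: sum_of_bool_eq)
    also have "\<dots> = of_bool (odd (card A))"
      unfolding A_def by (rule sum_of_bool_bit) simp
    finally show "odd (card A)"
      by (simp add: coef_mon flip: mon_empty split: if_splits)
    show "B \<subseteq> E \<times> {1..n}" by (auto simp: B_def K_def)
    show "\<forall>(e, k)\<in>B. \<exists>f\<in>bayer_system n E. coef (\<alpha> f) {#k#} = 1"
      by (auto simp: B_def K_def F)
    show "\<forall>M. size M = 3 \<longrightarrow>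
      coef ((\<Sum>i\<in>A. mon {#i, i, i#}) + (\<Sum>(e, k)\<in>B. mon {#k#} * edge_poly e)) M = 0"
    proof (intro allI impI)
      fix M :: "nat multiset" assume M: "size M = 3"
      have "coef 1 M = 0"
        using M by (simp add: coef_mon_size flip: mon_empty)
      also have "coef 1 M = (\<Sum>i=1..n. of_bool (c (vertex_poly i)) * coef (mon {#i, i, i#}) M)
         + (\<Sum>e\<in>E. \<Sum>k\<in>K (edge_poly e). coef (mon {#k#} * edge_poly e) M)"
        using one[of M] M by (simp add: v3 e3)
      also have "(\<Sum>i=1..n. of_bool (c (vertex_poly i)) * coef (mon {#i, i, i#}) M)
          = (\<Sum>i\<in>A. coef (mon {#i, i, i#}) M)"
        unfolding A_def by (rule sum.mono_neutral_cong_right) auto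
      also have "(\<Sum>e\<in>E. \<Sum>k\<in>K (edge_poly e). coef (mon {#k#} * edge_poly e) M)
          = (\<Sum>(e, k)\<in>B. coef (mon {#k#} * edge_poly e) M)"
        unfolding B_def using fE fK by (simp add: sum.Sigma)
      finally show "coef ((\<Sum>i\<in>A. mon {#i, i, i#}) + (\<Sum>(e, k)\<in>B. mon {#k#} * edge_poly e)) M = 0"
        by (simp add: coef_add coef_sum case_prod_unfold)
    qed
  qed
qed

section \<open>Path polynomials and their parity\<close>

text \<open>\<open>Max\<close> and \<open>Min\<close> only name the two vertices of an unordered
  pair; the sum is symmetric in them.\<close>

definition ends_poly :: "nat set \<Rightarrow> bit mpoly" where
  "ends_poly e = mon {#Max e, Max e, Min e#} + mon {#Min e, Min e, Max e#}"

definition path_poly :: "path2 \<Rightarrow> bit mpoly" where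
  "path_poly p = ends_poly (endpoints p) + (\<Sum>i\<in>endpoints p. mon {#middle p, middle p, i#})"

text \<open>The constant to which a path polynomial reduces once the terms that cancel over a cover are removed.\<close>

definition path_parity :: "nat set set \<Rightarrow> path2 \<Rightarrow> bit" where
  "path_parity E p = of_bool (endpoints p \<in> E) + (\<Sum>i\<in>endpoints p. of_bool (middle p < i))"

lemma ends_poly_pair: "i \<noteq> j \<Longrightarrow> ends_poly {i, j} = mon {#i, i, j#} + mon {#j, j, i#}"
  by (cases i j rule: linorder_cases) (simp_all add: ends_poly_def add.commute max_def min_def)

lemma length2_pathsE:
  assumes "p \<in> length2_paths E"
  obtains i j k where "p = (j, {i, k})" "i \<noteq> j" "j \<noteq> k" "i \<noteq> k" "{i, j} \<in> E" "{j, k} \<in> E"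
  using assms by (auto simp: length2_paths_def)

lemma path_poly_pair:
  "i \<noteq> k \<Longrightarrow> path_poly (j, {i, k}) =
     mon {#i, i, k#} + mon {#k, k, i#} + mon {#j, j, i#} + mon {#j, j, k#}"
  by (simp add: path_poly_def endpoints_def middle_def ends_poly_pair add.assoc)

text \<open>Each endpoint multiplies the polynomial of the edge from the middle to the other
  endpoint. The product of all three variables arises twice and cancels.\<close>

lemma path_poly_eq_sum_edges:
  assumes "p \<in> length2_paths E"
  shows "path_poly p = (\<Sum>i\<in>endpoints p. mon {#i#} * edge_poly (insert (middle p) (endpoints p - {i})))"
proof -
  obtain i j k where p: "p = (j, {i, k})" "i \<noteq> j" "j \<noteq> k" "i \<noteq> k"
    using assms by (rule length2_pathsE)
  have d: "{i, k} - {i} = {k}" "{i, k} - {k} = {i}" using p by auto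
  have "mon {#i#} * edge_poly {j, k} + mon {#k#} * edge_poly {j, i}
     = mon {#i, i, k#} + mon {#k, k, i#} + mon {#j, j, i#} + mon {#j, j, k#} +
       (mon {#i, j, k#} + mon {#i, j, k#}) + (mon {#i, i, k#} + mon {#i, i, k#}) + (mon {#i, k, k#} + mon {#i, k, k#})"
    using p by (simp add: mon_edge_poly add_mset_commute add_ac)
  then show ?thesis
    using p by (simp add: path_poly_pair endpoints_def middle_def d)
qed

lemma finite_length2_paths:
  assumes "simple_graph n E"
  shows "finite (length2_paths E)"
proof (rule finite_subset)
  show "length2_paths E \<subseteq> {1..n} \<times> Pow {1..n}"
  proof
    fix p assume "p \<in> length2_paths E"
    then obtain i j k where "p = (j, {i, k})" and e: "{i, j} \<in> E" "{j, k} \<in> E"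
      by (rule length2_pathsE)
    then show "p \<in> {1..n} \<times> Pow {1..n}"
      using simple_graphD[OF assms e(1)] simple_graphD[OF assms e(2)] by simp
  qed
qed simp

text \<open>Condition (3) removes the part of the parity that depends on the endpoints being an
  edge, leaving the count of condition (2).\<close>

lemma sum_path_parity:
  assumes sg: "simple_graph n E" and C: "C \<subseteq> length2_paths E"
    and ends: "\<And>i j. i \<in> {1..n} \<Longrightarrow> j \<in> {1..n} \<Longrightarrow> {i, j} \<notin> E \<Longrightarrow>
      even (card {p \<in> C. endpoints p = {i, j}})"
  shows "(\<Sum>p\<in>C. path_parity E p) = of_bool (odd (card {p \<in> C. (\<forall>i \<in> endpoints p. middle p < i) \<or>
    (\<forall>i \<in> endpoints p. middle p > i)}))"
proof -
  let ?\<kappa> = "\<lambda>p. (\<forall>i \<in> endpoints p. middle p < i) \<or> (\<forall>i \<in> endpoints p. middle p > i)"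
  have fin: "finite C" using C finite_length2_paths[OF sg] by (rule finite_subset)
  \<comment> \<open>The two comparisons in \<open>path_parity\<close> sum to 1 exactly when the
    middle lies between the endpoints. Negating both this and \<open>endpoints p \<in> E\<close>
    leaves the sum unchanged modulo 2.\<close>
  have path_parity: "path_parity E p = of_bool (endpoints p \<notin> E) + of_bool (?\<kappa> p)" if "p \<in> C" for p
  proof -
    from that C have "p \<in> length2_paths E" by blast
    then obtain i j k where "p = (j, {i, k})" "i \<noteq> j" "j \<noteq> k" "i \<noteq> k"
      by (rule length2_pathsE)
    then show ?thesis
      by (cases i j rule: linorder_cases; cases j k rule: linorder_cases)
         (auto simp: path_parity_def endpoints_def middle_def)
  qed
  \<comment> \<open>Split by endpoint pair: each class is even by condition (3).\<close>
  have "even (card {p \<in> C. endpoints p \<notin> E})"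
  proof -
    let ?N = "{p \<in> C. endpoints p \<notin> E}"
    have "card ?N = (\<Sum>y\<in>endpoints ` ?N. card {p \<in> ?N. endpoints p = y})"
      using fin sum.image_gen[of ?N "\<lambda>_. 1::nat" endpoints] by simp
    moreover have "even (card {p \<in> ?N. endpoints p = y})" if "y \<in> endpoints ` ?N" for y
    proof -
      from that obtain p where p: "p \<in> C" "endpoints p = y" "y \<notin> E" by auto
      from p(1) C have "p \<in> length2_paths E" by blast
      then obtain i j k where "p = (j, {i, k})" "{i, j} \<in> E" "{j, k} \<in> E"
        by (rule length2_pathsE)
      with p(2) have y: "y = {i, k}" "i \<in> {1..n}" "k \<in> {1..n}"
        using simple_graphD[OF sg] by (auto simp: endpoints_def)
      then have "{q \<in> ?N. endpoints q = y} = {q \<in> C. endpoints q = {i, k}}"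
        using p(3) by auto
      then show ?thesis using ends[of i k] y p(3) by simp
    qed
    ultimately show ?thesis by (simp add: dvd_sum)
  qed
  then show ?thesis
    using fin by (simp add: path_parity sum.distrib sum_of_bool_bit del: sum_of_bool_eq)
qed

section \<open>Grouping pairs (edge, vertex) into paths\<close>

lemma card_filter_pair:
  "x \<noteq> y \<Longrightarrow> card {q \<in> {x, y}. P q} = of_bool (P x) + of_bool (P y)"
  by (auto simp: Collect_conv_if conj_disj_distribR Collect_disj_eq)

lemma card_Int_triple:
  "distinct [x, y, z] \<Longrightarrow> card (B \<inter> {x, y, z}) = of_bool (x \<in> B) + of_bool (y \<in> B) + of_bool (z \<in> B)"
  by (simp add: Int_insert_right)

lemma mset_distinct_neq_square:
  assumes "a \<noteq> b" "b \<noteq> c" "a \<noteq> c"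
  shows "{#a, b, c#} \<noteq> {#u, u, v#}"
proof
  assume "{#a, b, c#} = {#u, u, v#}"
  then have "count {#a, b, c#} u = count {#u, u, v#} u" by simp
  then show False using assms by (simp split: if_splits)
qed

text \<open>Pairs with \<open>k \<in> e\<close> thus contribute a cube and a part symmetric in the
  two ends of the edge, which is why they do not disturb conditions (1) and (3).\<close>

lemma own_vertex_times_edge_poly:
  assumes "k \<noteq> l"
  shows "mon {#k#} * edge_poly {k, l} = mon {#k, k, k#} + ends_poly {k, l}"
  using assms by (simp add: mon_edge_poly ends_poly_pair add_mset_commute add_ac)

lemma coef_own_vertex_nonedge:
  assumes "{k, l} \<in> E" "k \<noteq> l" "{u, v} \<notin> E" "u \<noteq> v"
  shows "coef (mon {#k#} * edge_poly {k, l}) {#u, u, v#} = 0"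
  using assms
  by (auto simp: own_vertex_times_edge_poly ends_poly_pair coef_add coef_mon mset_square_eq_iff insert_commute)

lemma mset_distinct_eq_iff:
  assumes "distinct [u, v, w]" "i \<noteq> j"
  shows "{#i, j, k#} = {#u, v, w#} \<longleftrightarrow>
    ({i, j}, k) \<in> {({u, v}, w), ({u, w}, v), ({v, w}, u)}"
  using assms by (auto simp: add_eq_conv_ex doubleton_eq_iff)

text \<open>Only the mixed term of an edge polynomial can yield a squarefree cubic monomial; the
  three pairs are the ways to split a triple into an edge and a vertex.\<close>

lemma coef_distinct:
  assumes "distinct [u, v, w]" "e = {i, j}" "i \<noteq> j"
  shows "coef (mon {#k#} * edge_poly e) {#u, v, w#} =
    of_bool ((e, k) \<in> {({u, v}, w), ({u, w}, v), ({v, w}, u)})"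
proof -
  have n: "{#u, v, w#} \<noteq> {#i, i, k#}" "{#u, v, w#} \<noteq> {#j, j, k#}"
    using assms by (intro mset_distinct_neq_square; simp)+
  then show ?thesis
    using assms mset_distinct_eq_iff[OF assms(1,3), of k] n[symmetric]
    by (simp add: mon_edge_poly coef_add coef_mon)
qed

text \<open>In each triple of vertices, none or two of the three pairs lie in \<open>B\<close>. Two
  such pairs have edges sharing one vertex, the middle of a path; \<open>C\<close> consists of these
  paths and \<open>B''\<close> of the pairs with \<open>k \<in> e\<close>.\<close>

lemma linear_certificate_pathsE:
  assumes sg: "simple_graph n E"
    and B: "B \<subseteq> E \<times> {1..n}"
    and zero: "\<forall>M. size M = 3 \<longrightarrow>
       coef ((\<Sum>i\<in>A. mon {#i, i, i#}) + (\<Sum>(e, k)\<in>B. mon {#k#} * edge_poly e)) M = 0"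
  obtains B'' C where
    "\<forall>q\<in>B''. \<exists>k l. q = ({k, l}, k) \<and> {k, l} \<in> E \<and> k \<noteq> l"
    "C \<subseteq> length2_paths E"
    "\<forall>M. size M = 3 \<longrightarrow> (\<Sum>i\<in>A. coef (mon {#i, i, i#}) M) +
       (\<Sum>(e, k)\<in>B''. coef (mon {#k#} * edge_poly e) M) + (\<Sum>p\<in>C. coef (path_poly p) M) = 0"
proof -
  \<comment> \<open>\<open>\<phi>\<close> sends a path with a chosen endpoint to the edge avoiding
    that endpoint, paired with the endpoint.\<close>
  define \<phi> where "\<phi> q = (insert (middle (fst q)) (endpoints (fst q) - {snd q}), snd q)"
    for q :: "path2 \<times> nat"
  define T where "T = (\<lambda>(e, k). mon {#k#} * edge_poly e)"
  define C where "C = {p \<in> length2_paths E. \<forall>i\<in>endpoints p. \<phi> (p, i) \<in> B}"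
  define B' where "B' = {q \<in> B. snd q \<notin> fst q}"
  define B'' where "B'' = {q \<in> B. snd q \<in> fst q}"
  have finC: "finite C" using finite_length2_paths[OF sg] by (simp add: C_def)
  have finB: "finite B" using B simple_graph_finite[OF sg] by (meson finite_SigmaI finite_atLeastAtMost finite_subset)
  have BE: "e \<in> E" "k \<in> {1..n}" if "(e, k) \<in> B" for e k using B that by auto
  have C_iff: "(j, {i, k}) \<in> C \<longleftrightarrow> ({i, j}, k) \<in> B \<and> ({j, k}, i) \<in> B"
    if "distinct [i, j, k]" for i j k
  proof -
    have "{i, k} - {i} = {k}" "{i, k} - {k} = {i}" using that by auto
    moreover have "(j, {i, k}) \<in> length2_paths E" if "{i, j} \<in> E" "{j, k} \<in> E"
      using \<open>distinct [i, j, k]\<close> that by (auto simp: length2_paths_def)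
    ultimately show ?thesis
      using BE by (auto simp: C_def \<phi>_def endpoints_def middle_def insert_commute)
  qed
  have even3: "even (card (B \<inter> {({u, v}, w), ({u, w}, v), ({v, w}, u)}))"
    if d: "distinct [u, v, w]" for u v w
  proof -
    have "(\<Sum>i\<in>A. coef (mon {#i, i, i#}) {#u, v, w#}) = 0"
    proof (intro sum.neutral ballI)
      fix i
      have "{#u, v, w#} \<noteq> {#i, i, i#}" using d by (intro mset_distinct_neq_square) auto
      from this[symmetric] show "coef (mon {#i, i, i#}) {#u, v, w#} = 0" by (simp add: coef_mon)
    qed
    moreover have "coef (case q of (e, k) \<Rightarrow> mon {#k#} * edge_poly e) {#u, v, w#} =
        of_bool (q \<in> {({u, v}, w), ({u, w}, v), ({v, w}, u)})" if q: "q \<in> B" for q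
    proof -
      obtain e k where ek: "q = (e, k)" by (cases q)
      obtain i j where "e = {i, j}" "i \<noteq> j" using sg BE(1)[OF q[unfolded ek]] by (rule simple_graphE)
      from coef_distinct[OF d this, of k] show ?thesis by (simp only: ek prod.case)
    qed
    ultimately have "(\<Sum>q\<in>B. of_bool (q \<in> {({u, v}, w), ({u, w}, v), ({v, w}, u)}) :: bit) = 0"
      using zero[rule_format, of "{#u, v, w#}"] by (simp add: coef_add coef_sum)
    then show ?thesis
      using finB by (simp add: sum_of_bool_bit Int_def del: sum_of_bool_eq split: if_splits)
  qed
  \<comment> \<open>A pair in \<open>B'\<close> comes from exactly one path of \<open>C\<close>, any
    other pair from none: by \<open>even3\<close>, a pair of \<open>B\<close> with
    \<open>k \<notin> e\<close> has exactly one partner in its triple.\<close>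
  have fiber: "odd (card {q \<in> Sigma C endpoints. \<phi> q = (e, k)}) \<longleftrightarrow> (e, k) \<in> B'" for e k
  proof (cases "e \<in> E \<and> k \<notin> e")
    case False
    have "e \<in> E \<and> k \<notin> e" if "(p, k) \<in> Sigma C endpoints" "\<phi> (p, k) = (e, k)" for p
    proof -
      from that have p: "p \<in> length2_paths E" "k \<in> endpoints p" by (auto simp: C_def)
      from p(1) obtain i j l where p': "p = (j, {i, l})" "i \<noteq> j" "j \<noteq> l" "i \<noteq> l" "{i, j} \<in> E" "{j, l} \<in> E"
        by (rule length2_pathsE)
      moreover from p' p(2) have "k = i \<or> k = l" by (auto simp: endpoints_def)
      ultimately obtain m where m: "p = (j, {m, k})" "m \<noteq> k" "j \<noteq> k" "{m, k} - {k} = {m}" "{j, m} \<in> E"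
        by (auto simp: insert_commute)
      then have "e = {j, m}" using that(2) by (simp add: \<phi>_def endpoints_def middle_def)
      then show ?thesis using m by simp
    qed
    then have "{q \<in> Sigma C endpoints. \<phi> q = (e, k)} = {}"
      using False by (auto simp: \<phi>_def)
    moreover have "(e, k) \<notin> B'" using False BE by (auto simp: B'_def)
    ultimately show ?thesis by (metis card.empty even_zero)
  next
    case True
    then obtain u v where e: "e = {u, v}" "u \<noteq> v" using simple_graphE[OF sg] by metis
    with True have d: "distinct [u, v, k]" by auto
    \<comment> \<open>The middle must be an end of \<open>e\<close> and \<open>k\<close> an
      endpoint, which leaves two candidate paths.\<close>
    have "q \<in> {((u, {v, k}), k), ((v, {u, k}), k)}" if q0: "q \<in> Sigma C endpoints" "\<phi> q = (e, k)" for q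
    proof -
      obtain p where q: "q = (p, k)" using q0(2) by (cases q) (auto simp: \<phi>_def)
      from q0 q have p: "p \<in> length2_paths E" "k \<in> endpoints p" by (auto simp: C_def)
      from p(1) obtain i j l where "p = (j, {i, l})" "i \<noteq> j" "j \<noteq> l" "i \<noteq> l"
        by (rule length2_pathsE)
      moreover from this p(2) have "k = i \<or> k = l" by (auto simp: endpoints_def)
      ultimately obtain m where m: "p = (j, {m, k})" "m \<noteq> k" "{m, k} - {k} = {m}" by auto
      then have "{j, m} = {u, v}" using q0(2) q e(1) by (simp add: \<phi>_def endpoints_def middle_def)
      then show ?thesis using q m(1) by (auto simp: doubleton_eq_iff)
    qed
    moreover have "\<phi> ((u, {v, k}), k) = (e, k)" "\<phi> ((v, {u, k}), k) = (e, k)"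
      using d e by (auto simp: \<phi>_def endpoints_def middle_def)
    ultimately have eq: "{q \<in> Sigma C endpoints. \<phi> q = (e, k)} =
      {q \<in> {((u, {v, k}), k), ((v, {u, k}), k)}. fst q \<in> C}"
      by (auto simp: endpoints_def)
    have c: "(u, {v, k}) \<in> C \<longleftrightarrow> ({u, v}, k) \<in> B \<and> ({u, k}, v) \<in> B"
      "(v, {u, k}) \<in> C \<longleftrightarrow> ({u, v}, k) \<in> B \<and> ({v, k}, u) \<in> B"
      using C_iff[of v u k] C_iff[of u v k] d by (auto simp: insert_commute)
    have ne: "distinct [({u, v}, k), ({u, k}, v), ({v, k}, u)]"
      using d by auto
    have "card {q \<in> Sigma C endpoints. \<phi> q = (e, k)} =
        of_bool ((u, {v, k}) \<in> C) + of_bool ((v, {u, k}) \<in> C)"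
      unfolding eq using e(2) by (subst card_filter_pair) simp_all
    then show ?thesis
      using even3[OF d] True unfolding card_Int_triple[OF ne] c B'_def e(1)
      by (auto split: if_splits)
  qed
  have B'_eq: "{y. odd (card {q \<in> Sigma C endpoints. \<phi> q = y})} = B'"
    using fiber by auto
  have "(\<Sum>q\<in>B'. T q) = (\<Sum>q\<in>Sigma C endpoints. T (\<phi> q))"
  proof -
    have "finite (endpoints p)" if "p \<in> C" for p
      using that by (auto simp: C_def length2_paths_def endpoints_def)
    then have "finite (Sigma C endpoints)" using finC by blast
    from sum_odd_fibers[OF this, of T \<phi>] show ?thesis unfolding B'_eq by simp
  qed
  also have "\<dots> = (\<Sum>p\<in>C. path_poly p)"
  proof -
    have "(\<Sum>i\<in>endpoints p. T (\<phi> (p, i))) = path_poly p" if "p \<in> C" for p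
      using that by (subst path_poly_eq_sum_edges) (auto simp: C_def T_def \<phi>_def)
    moreover have "finite (endpoints p)" if "p \<in> C" for p
      using that by (auto simp: C_def length2_paths_def endpoints_def)
    ultimately show ?thesis
      using finC sum.Sigma[of C endpoints "\<lambda>p i. T (\<phi> (p, i))"] by (simp add: case_prod_unfold)
  qed
  finally have B': "(\<Sum>q\<in>B'. T q) = (\<Sum>p\<in>C. path_poly p)" .
  have "(\<Sum>q\<in>B. T q) = (\<Sum>q\<in>B'. T q) + (\<Sum>q\<in>B''. T q)"
    using finB by (subst sum.union_disjoint[symmetric]) (auto simp: B'_def B''_def intro!: sum.cong)
  then have BT: "sum T B = (\<Sum>p\<in>C. path_poly p) + (\<Sum>q\<in>B''. T q)" by (simp only: B')
  have key: "(\<Sum>i\<in>A. coef (mon {#i, i, i#}) M) + (\<Sum>q\<in>B''. coef (T q) M) + (\<Sum>p\<in>C. coef (path_poly p) M) = 0"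
    if "size M = 3" for M
    using zero[rule_format, OF that, folded T_def] unfolding BT
    by (simp only: coef_add coef_sum) (simp only: add_ac)
  have B''E: "\<exists>k l. q = ({k, l}, k) \<and> {k, l} \<in> E \<and> k \<noteq> l" if mem: "q \<in> B''" for q
  proof -
    obtain e k where q: "q = (e, k)" "e \<in> E" "k \<in> e" using mem BE by (cases q) (auto simp: B''_def)
    then obtain i j where "e = {i, j}" "i \<noteq> j" using simple_graphE[OF sg] by metis
    with q show ?thesis by (auto simp: insert_commute)
  qed
  show thesis
  proof
    show "\<forall>q\<in>B''. \<exists>k l. q = ({k, l}, k) \<and> {k, l} \<in> E \<and> k \<noteq> l" using B''E by blast
    show "C \<subseteq> length2_paths E" by (auto simp: C_def)
    show "\<forall>M. size M = 3 \<longrightarrow> (\<Sum>i\<in>A. coef (mon {#i, i, i#}) M) +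
       (\<Sum>(e, k)\<in>B''. coef (mon {#k#} * edge_poly e) M) + (\<Sum>p\<in>C. coef (path_poly p) M) = 0"
      using key by (simp add: T_def case_prod_unfold)
  qed
qed

section \<open>Reading off the cover conditions from coefficients\<close>

lemma covered_of_path_decomposition:
  assumes sg: "simple_graph n E"
    and A: "A \<subseteq> {1..n}" "odd (card A)"
    and own: "\<forall>q\<in>B. \<exists>k l. q = ({k, l}, k) \<and> {k, l} \<in> E \<and> k \<noteq> l"
    and C: "C \<subseteq> length2_paths E"
    and zero: "\<forall>M. size M = 3 \<longrightarrow> (\<Sum>i\<in>A. coef (mon {#i, i, i#}) M) +
       (\<Sum>(e, k)\<in>B. coef (mon {#k#} * edge_poly e) M) + (\<Sum>p\<in>C. coef (path_poly p) M) = 0"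
  shows "covered_by_length2_paths n E"
proof -
  define T where "T = (\<lambda>(e, k). mon {#k#} * edge_poly e)"
  have finC: "finite C" using C finite_length2_paths[OF sg] by (rule finite_subset)
  have key: "(\<Sum>i\<in>A. coef (mon {#i, i, i#}) M) + (\<Sum>q\<in>B. coef (T q) M) + (\<Sum>p\<in>C. coef (path_poly p) M) = 0"
    if "size M = 3" for M
    using zero that by (simp add: T_def case_prod_unfold)
  have BE: "\<exists>k l. q = ({k, l}, k) \<and> {k, l} \<in> E \<and> k \<noteq> l" if "q \<in> B" for q
    using own that by blast
  have CE: "\<exists>i j k. p = (j, {i, k}) \<and> i \<noteq> j \<and> j \<noteq> k \<and> i \<noteq> k \<and> {i, j} \<in> E \<and> {j, k} \<in> E" if "p \<in> C" for p
    using that C by (auto simp: length2_paths_def)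
  \<comment> \<open>Condition (3): at a nonedge with distinct \<open>u\<close>, \<open>v\<close>,
    the monomial x_u^2 x_v occurs in no cube and in no term from \<open>B\<close>, and in a path
    polynomial only through its endpoints. For \<open>u = v\<close> there is no such path.\<close>
  have ends: "even (card {p \<in> C. endpoints p = {u, v}})"
    if "{u, v} \<notin> E" for u v
  proof (cases "u = v")
    case True
    have "{p \<in> C. endpoints p = {u, v}} = {}"
      using CE True by (fastforce simp: endpoints_def)
    then show ?thesis by (metis card.empty even_zero)
  next
    case False
    have "(\<Sum>i\<in>A. coef (mon {#i, i, i#}) {#u, u, v#}) = 0"
      using False by (intro sum.neutral) (simp add: coef_mon mset_square_eq_iff)
    moreover have "(\<Sum>q\<in>B. coef (T q) {#u, u, v#}) = 0"
      using False that BE by (intro sum.neutral) (force simp: T_def coef_own_vertex_nonedge)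
    moreover have "coef (path_poly p) {#u, u, v#} = of_bool (endpoints p = {u, v})" if mem: "p \<in> C" for p
    proof -
      obtain i j k where p: "p = (j, {i, k})" "i \<noteq> j" "j \<noteq> k" "i \<noteq> k" "{i, j} \<in> E" "{j, k} \<in> E"
        using CE[OF mem] by blast
      moreover from p \<open>{u, v} \<notin> E\<close> have "\<not> (j = u \<and> i = v)" "\<not> (j = u \<and> k = v)"
        by (auto simp: insert_commute)
      ultimately show ?thesis
        by (cases "i = u"; cases "k = u")
          (simp_all add: path_poly_pair coef_add coef_mon mset_square_eq_iff endpoints_def doubleton_eq_iff)
    qed
    ultimately have "(\<Sum>p\<in>C. of_bool (endpoints p = {u, v}) :: bit) = 0"
      using key[of "{#u, u, v#}"] by simp
    then show ?thesis
      using finC by (simp add: sum_of_bool_bit del: sum_of_bool_eq split: if_splits)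
  qed
  \<comment> \<open>Condition (1): adding the coefficients of x_u^2 x_v and x_v^2 x_u cancels all
    that is symmetric in the two, namely the terms from \<open>B\<close> and the ends of paths. What
    remains counts the paths through the edge.\<close>
  have edges: "even (card {p \<in> C. {u, v} \<in> path_edges p})" if "{u, v} \<in> E" for u v
  proof -
    have uv: "u \<noteq> v" using simple_graphD(1)[OF sg that] .
    have "(\<Sum>i\<in>A. coef (mon {#i, i, i#}) {#u, u, v#}) = 0" "(\<Sum>i\<in>A. coef (mon {#i, i, i#}) {#v, v, u#}) = 0"
      using uv by (auto intro!: sum.neutral simp: coef_mon mset_square_eq_iff)
    moreover have "coef (T q) {#u, u, v#} = coef (T q) {#v, v, u#}" if "q \<in> B" for q
      using BE[OF that] uv
      by (auto simp: T_def own_vertex_times_edge_poly ends_poly_pair coef_add coef_mon mset_square_eq_iff)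
    then have "(\<Sum>q\<in>B. coef (T q) {#u, u, v#}) = (\<Sum>q\<in>B. coef (T q) {#v, v, u#})"
      by (rule sum.cong[OF refl])
    moreover have "coef (path_poly p) {#u, u, v#} + coef (path_poly p) {#v, v, u#} = of_bool ({u, v} \<in> path_edges p)"
      if "p \<in> C" for p
    proof -
      obtain i j k where p: "p = (j, {i, k})" "i \<noteq> j" "j \<noteq> k" "i \<noteq> k" using CE[OF \<open>p \<in> C\<close>] by blast
      then have "path_edges p = {{i, j}, {k, j}}"
        by (auto simp: path_edges_def endpoints_def middle_def)
      then have mem: "{u, v} \<in> path_edges p \<longleftrightarrow>
          j = u \<and> i = v \<or> j = u \<and> k = v \<or> j = v \<and> i = u \<or> j = v \<and> k = u"
        by (auto simp: doubleton_eq_iff)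
      have coefs: "coef (path_poly p) {#u, u, v#} + coef (path_poly p) {#v, v, u#} =
          of_bool (j = u \<and> i = v) + of_bool (j = u \<and> k = v) +
          of_bool (j = v \<and> i = u) + of_bool (j = v \<and> k = u)"
        using p by (simp add: path_poly_pair coef_add coef_mon mset_square_eq_iff conj_commute add_ac)
      show ?thesis
        unfolding mem coefs using p(2-4) uv by (auto simp: of_bool_disj_bit add_ac)
    qed
    then have "(\<Sum>p\<in>C. of_bool ({u, v} \<in> path_edges p) :: bit) =
      (\<Sum>p\<in>C. coef (path_poly p) {#u, u, v#}) + (\<Sum>p\<in>C. coef (path_poly p) {#v, v, u#})"
      by (simp add: sum.distrib[symmetric])
    ultimately have "(\<Sum>p\<in>C. of_bool ({u, v} \<in> path_edges p) :: bit) = 0"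
      using key[of "{#u, u, v#}"] key[of "{#v, v, u#}"]
      by (metis (no_types, lifting) add.left_commute add.right_neutral add_self_bit add.commute size_add_mset size_empty numeral_3_eq_3)
    then show ?thesis
      using finC by (simp add: sum_of_bool_bit del: sum_of_bool_eq split: if_splits)
  qed
  define D where "D = {(i, j). i < j \<and> {i, j} \<in> E}"
  have finD: "finite D"
    by (rule finite_subset[of _ "{1..n} \<times> {1..n}"]) (use simple_graphD[OF sg] in \<open>auto simp: D_def\<close>)
  \<comment> \<open>This additive functional is chosen to vanish on the terms from \<open>B\<close>
    and to take a path polynomial to its parity.\<close>
  define L where "L p = (\<Sum>i=1..n. coef p {#i, i, i#}) + (\<Sum>(i, j)\<in>D. coef p {#i, i, j#})" for p
  have L_add: "L (p + q) = L p + L q" for p q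
    by (simp add: L_def coef_add sum.distrib case_prod_unfold add_ac)
  have L_sq: "L (mon {#i, i, j#}) = of_bool (i < j \<and> {i, j} \<in> E)" if "i \<noteq> j" for i j
  proof -
    have "(\<Sum>q\<in>D. of_bool (q = (i, j)) :: bit) = of_bool ((i, j) \<in> D)"
      using finD by (simp add: of_bool_def)
    moreover have "(\<Sum>(u, v)\<in>D. coef (mon {#i, i, j#}) {#u, u, v#}) = (\<Sum>q\<in>D. of_bool (q = (i, j)))"
      by (intro sum.cong) (auto simp: coef_mon mset_square_eq_iff)
    moreover have "(\<Sum>u=1..n. coef (mon {#i, i, j#}) {#u, u, u#}) = 0"
      using that by (intro sum.neutral) (auto simp: coef_mon mset_square_eq_iff)
    ultimately show ?thesis by (simp add: L_def D_def)
  qed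
  have L_cube: "L (mon {#i, i, i#}) = 1" if "i \<in> {1..n}" for i
  proof -
    have "(\<Sum>(u, v)\<in>D. coef (mon {#i, i, i#}) {#u, u, v#}) = 0"
      by (intro sum.neutral) (auto simp: coef_mon mset_square_eq_iff D_def)
    moreover have "(\<Sum>u=1..n. coef (mon {#i, i, i#}) {#u, u, u#}) = 1"
      using that by (simp add: coef_mon mset_square_eq_iff of_bool_def)
    ultimately show ?thesis by (simp add: L_def)
  qed
  \<comment> \<open>The cube counts once, and so does exactly one of the two mixed terms, the one
    squaring the smaller vertex.\<close>
  have L_T: "L (T q) = 0" if mem: "q \<in> B" for q
  proof -
    obtain k l where q: "q = ({k, l}, k)" "{k, l} \<in> E" "k \<noteq> l" using BE[OF mem] by blast
    moreover have "k \<in> {1..n}" using simple_graphD[OF sg q(2)] by blast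
    ultimately show ?thesis
      by (cases k l rule: linorder_cases)
        (simp_all add: T_def own_vertex_times_edge_poly ends_poly_pair L_add L_sq L_cube insert_commute)
  qed
  \<comment> \<open>The ends count once if they form an edge; each middle square counts if the
    middle is the smaller vertex.\<close>
  have L_P: "L (path_poly p) = path_parity E p" if mem: "p \<in> C" for p
  proof -
    obtain i j k where p: "p = (j, {i, k})" "i \<noteq> j" "j \<noteq> k" "i \<noteq> k" "{i, j} \<in> E" "{j, k} \<in> E"
      using CE[OF mem] by blast
    then show ?thesis
      by (cases i k rule: linorder_cases)
        (simp_all add: path_poly_pair L_add L_sq insert_commute path_parity_def endpoints_def middle_def add_ac)
  qed
  have L_sum: "L (sum f X) = (\<Sum>x\<in>X. L (f x))" for f :: "'x \<Rightarrow> bit mpoly" and X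
  proof -
    have "(\<Sum>x\<in>X. \<Sum>i=1..n. coef (f x) {#i, i, i#}) = (\<Sum>i=1..n. \<Sum>x\<in>X. coef (f x) {#i, i, i#})"
      "(\<Sum>x\<in>X. \<Sum>q\<in>D. coef (f x) {#fst q, fst q, snd q#}) = (\<Sum>q\<in>D. \<Sum>x\<in>X. coef (f x) {#fst q, fst q, snd q#})"
      by (rule sum.swap)+
    then show ?thesis by (simp add: L_def coef_sum sum.distrib case_prod_unfold)
  qed
  \<comment> \<open>Applying \<open>L\<close> to the whole identity leaves the odd size of
    \<open>A\<close> against the sum of the path parities, hence condition (2).\<close>
  have "L ((\<Sum>i\<in>A. mon {#i, i, i#}) + (\<Sum>q\<in>B. T q) + (\<Sum>p\<in>C. path_poly p)) = 0"
    using key by (auto simp: L_def coef_add coef_sum intro!: sum.neutral)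
  moreover have "(\<Sum>i\<in>A. L (mon {#i, i, i#})) = 1"
    using A by (simp add: L_cube subset_iff of_nat_bit)
  ultimately have "(\<Sum>p\<in>C. path_parity E p) = 1"
    by (cases "\<Sum>p\<in>C. path_parity E p") (simp_all add: L_add L_sum L_T L_P)
  then have "odd (card {p \<in> C. (\<forall>i \<in> endpoints p. middle p < i) \<or> (\<forall>i \<in> endpoints p. middle p > i)})"
    using sum_path_parity[OF sg C ends] by (simp split: if_splits)
  moreover have "even (card {p \<in> C. e \<in> path_edges p})" if e: "e \<in> E" for e
  proof -
    obtain i j where "e = {i, j}" using sg e by (rule simple_graphE)
    then show ?thesis using edges e by simp
  qed
  ultimately show ?thesis
    unfolding covered_by_length2_paths_def using C ends by blast
qed

section \<open>From a cover to a certificate\<close>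

text \<open>With coefficients bounded in degree this is treated as an additive group rather than an
  ideal. It contains 1 exactly when there is a certificate of degree at most 1.\<close>

definition lspan :: "nat \<Rightarrow> bit mpoly set \<Rightarrow> bit mpoly set" where
  "lspan n F = {\<Sum>f\<in>F. \<alpha> f * f | \<alpha>. \<forall>f\<in>F. \<alpha> f \<in> lin n}"

lemma lspan_0: "0 \<in> lspan n F"
  unfolding lspan_def by (auto intro!: exI[of _ "\<lambda>_. 0"] simp: lin_0)

lemma lspan_add:
  assumes "p \<in> lspan n F" "q \<in> lspan n F"
  shows "p + q \<in> lspan n F"
proof -
  from assms obtain \<alpha> \<beta> where "p = (\<Sum>f\<in>F. \<alpha> f * f)" "\<forall>f\<in>F. \<alpha> f \<in> lin n"
    "q = (\<Sum>f\<in>F. \<beta> f * f)" "\<forall>f\<in>F. \<beta> f \<in> lin n"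
    unfolding lspan_def by blast
  then have "p + q = (\<Sum>f\<in>F. (\<alpha> f + \<beta> f) * f)" "\<forall>f\<in>F. \<alpha> f + \<beta> f \<in> lin n"
    by (simp_all add: distrib_right sum.distrib lin_add)
  then show ?thesis
    unfolding lspan_def by (intro CollectI exI[of _ "\<lambda>f. \<alpha> f + \<beta> f"] conjI)
qed

lemma lspan_sum: "(\<And>x. x \<in> X \<Longrightarrow> h x \<in> lspan n F) \<Longrightarrow> (\<Sum>x\<in>X. h x) \<in> lspan n F"
  by (induction X rule: infinite_finite_induct) (auto simp: lspan_0 lspan_add)

lemma lspan_base:
  assumes "finite F" "f \<in> F" "q \<in> lin n"
  shows "q * f \<in> lspan n F"
proof -
  have "(\<Sum>g\<in>F. (if g = f then q else 0) * g) = (\<Sum>g\<in>F. if g = f then q * g else 0)"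
    by (intro sum.cong) auto
  also have "\<dots> = q * f" using assms by simp
  finally have "q * f = (\<Sum>g\<in>F. (if g = f then q else 0) * g)" by (rule sym)
  moreover have "\<forall>g\<in>F. (if g = f then q else 0) \<in> lin n" using assms by (simp add: lin_0)
  ultimately show ?thesis
    unfolding lspan_def by (auto intro!: exI[of _ "\<lambda>g. if g = f then q else 0"])
qed

lemma finite_bayer_system: "simple_graph n E \<Longrightarrow> finite (bayer_system n E :: bit mpoly set)"
  by (simp add: bayer_system_eq simple_graph_finite)

lemma lspan_edge:
  assumes "simple_graph n E" "e \<in> E" "k \<in> {1..n}"
  shows "mon {#k#} * edge_poly e \<in> lspan n (bayer_system n E)"
  using assms by (intro lspan_base finite_bayer_system) (auto simp: bayer_system_eq lin_mon)

lemma lspan_vertex: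
  assumes "simple_graph n E" "k \<in> {1..n}"
  shows "vertex_poly k \<in> lspan n (bayer_system n E)"
  using lspan_base[OF finite_bayer_system, of n E "vertex_poly k" 1] assms
  by (simp add: bayer_system_eq lin_1)

text \<open>Multiplying the edge polynomial by one end and adding the vertex polynomial of that end
  cancels the cube.\<close>

lemma lspan_ends_poly:
  assumes "simple_graph n E" "{i, j} \<in> E"
  shows "ends_poly {i, j} + 1 \<in> lspan n (bayer_system n E)"
proof -
  note ij = simple_graphD[OF assms]
  have "mon {#i#} * edge_poly {i, j} + vertex_poly i = mon {#i, i, i#} + mon {#i, i, i#} + (ends_poly {i, j} + 1)"
    using ij by (simp add: own_vertex_times_edge_poly vertex_poly_def add_ac)
  then show ?thesis
    using lspan_add[OF lspan_edge[OF assms ij(2)] lspan_vertex[OF assms(1) ij(2)]] by simp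
qed

text \<open>A common representative for both mixed monomials of an edge, so that path contributions
  along the edge can cancel whichever end is the middle.\<close>

definition square_poly :: "nat set \<Rightarrow> bit mpoly" where
  "square_poly e = mon {#Max e, Max e, Min e#}"

text \<open>If \<open>i\<close> is the larger vertex the monomial is the representative; otherwise
  the two add up to \<open>ends_poly\<close>, which reduces to 1.\<close>

lemma lspan_square_poly:
  assumes "simple_graph n E" "{i, j} \<in> E"
  shows "mon {#i, i, j#} + square_poly {i, j} + of_bool (i < j) \<in> lspan n (bayer_system n E)"
proof (cases "i < j")
  case True
  then have "mon {#i, i, j#} + square_poly {i, j} + of_bool (i < j) = ends_poly {i, j} + 1"
    using ends_poly_pair[of i j] by (simp add: square_poly_def max_def min_def)
  then show ?thesis using lspan_ends_poly[OF assms] by simp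
next
  case False
  moreover have "i \<noteq> j" using simple_graphD[OF assms] by blast
  ultimately have "mon {#i, i, j#} + square_poly {i, j} + of_bool (i < j) = 0"
    by (simp add: square_poly_def max_def min_def)
  then show ?thesis using lspan_0 by metis
qed

lemma single_of_bool: "Poly_Mapping.single 0 (of_bool P) = (of_bool P :: bit mpoly)"
  by (cases P) simp_all

text \<open>Reduce a path polynomial: its ends become 1 when they form an edge, and each middle
  square becomes its representative plus a bit. The bits add up to
  \<open>path_parity\<close>.\<close>

lemma lspan_path:
  assumes sg: "simple_graph n E" and p: "p \<in> length2_paths E"
  shows "of_bool (endpoints p \<notin> E) * ends_poly (endpoints p) +
    (\<Sum>i\<in>endpoints p. square_poly {middle p, i}) + Poly_Mapping.single 0 (path_parity E p) \<in> lspan n (bayer_system n E)"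
proof -
  obtain i j k where P: "p = (j, {i, k})" "i \<noteq> j" "j \<noteq> k" "i \<noteq> k" "{i, j} \<in> E" "{j, k} \<in> E"
    using p by (rule length2_pathsE)
  have V: "i \<in> {1..n}" "j \<in> {1..n}" "k \<in> {1..n}"
    using simple_graphD[OF sg P(5)] simple_graphD[OF sg P(6)] by auto
  have "path_poly p = mon {#i#} * edge_poly {j, k} + mon {#k#} * edge_poly {i, j}"
    using P path_poly_eq_sum_edges[OF p]
    by (simp add: endpoints_def middle_def insert_Diff_if insert_commute)
  then have 1: "path_poly p \<in> lspan n (bayer_system n E)"
    using lspan_add[OF lspan_edge[OF sg P(6) V(1)] lspan_edge[OF sg P(5) V(3)]] by simp
  have 2: "of_bool (endpoints p \<in> E) * (ends_poly (endpoints p) + 1) \<in> lspan n (bayer_system n E)"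
    using lspan_ends_poly[OF sg, of i k] P by (simp add: endpoints_def lspan_0 of_bool_def)
  have 3: "mon {#j, j, i#} + square_poly {j, i} + of_bool (j < i) \<in> lspan n (bayer_system n E)"
    "mon {#j, j, k#} + square_poly {j, k} + of_bool (j < k) \<in> lspan n (bayer_system n E)"
    using lspan_square_poly[OF sg, of j i] lspan_square_poly[OF sg, of j k] P by (simp_all only: insert_commute)
  have "ends_poly {i, k} + of_bool ({i, k} \<in> E) * (ends_poly {i, k} + 1) =
    of_bool ({i, k} \<notin> E) * ends_poly {i, k} + of_bool ({i, k} \<in> E)"
    by simp
  moreover have "path_poly p = ends_poly {i, k} + mon {#j, j, i#} + mon {#j, j, k#}"
    using P by (simp add: path_poly_pair ends_poly_pair)
  \<comment> \<open>Here \<open>y\<close> and \<open>z\<close> are the middle squares, which occur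
    once in the path polynomial and once in its reductions.\<close>
  moreover have "x + y + z + u + (y + h + v) + (z + h' + w) = x + u + (h + h') + (v + w)"
    for x y z u h h' v w :: "bit mpoly"
  proof -
    have "x + y + z + u + (y + h + v) + (z + h' + w) = (y + y) + ((z + z) + (x + u + (h + h') + (v + w)))"
      by (simp only: add_ac)
    then show ?thesis by (simp only: add_self_mpoly add_0)
  qed
  ultimately have "path_poly p + of_bool (endpoints p \<in> E) * (ends_poly (endpoints p) + 1) +
      (mon {#j, j, i#} + square_poly {j, i} + of_bool (j < i)) + (mon {#j, j, k#} + square_poly {j, k} + of_bool (j < k))
    = (of_bool ({i, k} \<notin> E) * ends_poly {i, k} + of_bool ({i, k} \<in> E)) +
      (square_poly {j, i} + square_poly {j, k}) + (of_bool (j < i) + of_bool (j < k))"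
    using P(1) by (simp add: endpoints_def)
  also have "\<dots> = of_bool (endpoints p \<notin> E) * ends_poly (endpoints p) +
    (\<Sum>i\<in>endpoints p. square_poly {middle p, i}) + Poly_Mapping.single 0 (path_parity E p)"
    using P by (simp add: path_parity_def endpoints_def middle_def single_add single_of_bool add_ac)
  finally show ?thesis
    using lspan_add[OF lspan_add[OF lspan_add[OF 1 2] 3(1)] 3(2)] by simp
qed

text \<open>Sum the reduced path polynomials over the cover: nonedge ends cancel by condition (3),
  edge representatives by (1), and the constants sum to 1 by (2).\<close>

lemma one_in_lspan:
  assumes sg: "simple_graph n E" and "covered_by_length2_paths n E"
  shows "1 \<in> lspan n (bayer_system n E)"
proof -
  from assms(2) obtain C where C: "C \<subseteq> length2_paths E"
    and edges: "\<And>e. e \<in> E \<Longrightarrow> even (card {p \<in> C. e \<in> path_edges p})"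
    and mid: "odd (card {p \<in> C. (\<forall>i \<in> endpoints p. middle p < i) \<or> (\<forall>i \<in> endpoints p. middle p > i)})"
    and ends: "\<And>i j. i \<in> {1..n} \<Longrightarrow> j \<in> {1..n} \<Longrightarrow> {i, j} \<notin> E \<Longrightarrow>
      even (card {p \<in> C. endpoints p = {i, j}})"
    unfolding covered_by_length2_paths_def by blast
  have fin: "finite C" using C finite_length2_paths[OF sg] by (rule finite_subset)
  have CE: "\<exists>i j k. p = (j, {i, k}) \<and> i \<noteq> j \<and> j \<noteq> k \<and> i \<noteq> k \<and> {i, j} \<in> E \<and> {j, k} \<in> E" if "p \<in> C" for p
    using that C by (auto simp: length2_paths_def)
  have finend: "finite (endpoints p)" if "p \<in> C" for p
    using CE[OF that] by (auto simp: endpoints_def)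
  have "y \<in> E" if odd: "odd (card {p \<in> C. endpoints p = y})" for y
  proof (rule ccontr)
    assume "y \<notin> E"
    have "{p \<in> C. endpoints p = y} \<noteq> {}" using odd by (metis card.empty even_zero)
    then obtain p where p: "p \<in> C" "endpoints p = y" by blast
    obtain i j k where ijk: "p = (j, {i, k})" "{i, j} \<in> E" "{j, k} \<in> E" using CE[OF p(1)] by blast
    then have "i \<in> {1..n}" "k \<in> {1..n}"
      using simple_graphD[OF sg ijk(2)] simple_graphD[OF sg ijk(3)] by auto
    then show False using ends[of i k] ijk(1) p(2) odd \<open>y \<notin> E\<close> by (simp add: endpoints_def)
  qed
  then have g: "(\<Sum>p\<in>C. of_bool (endpoints p \<notin> E) * ends_poly (endpoints p)) = 0"
    using sum_odd_fibers[OF fin, of "\<lambda>y. of_bool (y \<notin> E) * ends_poly y" endpoints] by simp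
  \<comment> \<open>A path through \<open>e\<close> reaches it from only one of its endpoints, so
    these incidences are counted by the paths containing \<open>e\<close>.\<close>
  have "even (card {q \<in> Sigma C endpoints. {middle (fst q), snd q} = e})" for e
  proof -
    have "bij_betw fst {q \<in> Sigma C endpoints. {middle (fst q), snd q} = e} {p \<in> C. e \<in> path_edges p}"
    proof (rule bij_betw_imageI)
      show "inj_on fst {q \<in> Sigma C endpoints. {middle (fst q), snd q} = e}"
        by (rule inj_onI) (auto simp: doubleton_eq_iff)
      show "fst ` {q \<in> Sigma C endpoints. {middle (fst q), snd q} = e} = {p \<in> C. e \<in> path_edges p}"
        by (force simp: path_edges_def insert_commute image_iff)
    qed
    then have "card {q \<in> Sigma C endpoints. {middle (fst q), snd q} = e} = card {p \<in> C. e \<in> path_edges p}"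
      by (rule bij_betw_same_card)
    moreover have "even (card {p \<in> C. e \<in> path_edges p})"
    proof (cases "e \<in> E")
      case False
      have "e \<notin> path_edges p" if "p \<in> C" for p
        using CE[OF that] False by (auto simp: path_edges_def endpoints_def middle_def insert_commute)
      then have "{p \<in> C. e \<in> path_edges p} = {}" by blast
      then show ?thesis by (metis card.empty even_zero)
    qed (rule edges)
    ultimately show ?thesis by simp
  qed
  moreover have "finite (Sigma C endpoints)" using fin finend by blast
  ultimately have "(\<Sum>q\<in>Sigma C endpoints. square_poly {middle (fst q), snd q}) = 0"
    using sum_odd_fibers[of "Sigma C endpoints" square_poly "\<lambda>q. {middle (fst q), snd q}"] by simp
  then have h: "(\<Sum>p\<in>C. \<Sum>i\<in>endpoints p. square_poly {middle p, i}) = 0"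
    using sum.Sigma[of C endpoints "\<lambda>p i. square_poly {middle p, i}"] fin finend
    by (simp add: case_prod_unfold)
  have single_sum: "(\<Sum>p\<in>X. Poly_Mapping.single 0 (path_parity E p)) = (Poly_Mapping.single 0 (\<Sum>p\<in>X. path_parity E p) :: bit mpoly)" for X
    by (induction X rule: infinite_finite_induct) (simp_all add: single_add)
  have "(\<Sum>p\<in>C. path_parity E p) = 1" using sum_path_parity[OF sg C ends] mid by simp
  then have "(\<Sum>p\<in>C. of_bool (endpoints p \<notin> E) * ends_poly (endpoints p) +
    (\<Sum>i\<in>endpoints p. square_poly {middle p, i}) + Poly_Mapping.single 0 (path_parity E p)) = 1"
    unfolding sum.distrib g h single_sum by simp
  moreover have "(\<Sum>p\<in>C. of_bool (endpoints p \<notin> E) * ends_poly (endpoints p) +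
    (\<Sum>i\<in>endpoints p. square_poly {middle p, i}) + Poly_Mapping.single 0 (path_parity E p)) \<in> lspan n (bayer_system n E)"
    using lspan_path[OF sg] C by (intro lspan_sum) blast
  ultimately show ?thesis by metis
qed

section \<open>Certificate degrees and the equivalence\<close>

text \<open>An empty sum would give 1 = 0. Nonemptiness makes the \<open>Max\<close> in
  \<open>certificate_degree\<close> meaningful.\<close>

lemma certificate_nonempty:
  assumes "nullstellensatz_certificate n F \<alpha>"
  shows "F \<noteq> {}"
  using assms by (auto simp: nullstellensatz_certificate_def)

lemma certificate_degree_le:
  fixes F :: "bit mpoly set"
  assumes "finite F" "nullstellensatz_certificate n F \<alpha>" 
  shows "certificate_degree F \<alpha> \<le> d \<longleftrightarrow> (\<forall>f\<in>F. total_degree (\<alpha> f) \<le> d)"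
  using assms certificate_nonempty[OF assms(2)] by (simp add: certificate_degree_def)

text \<open>Constant coefficients force \<open>B\<close> to be empty, so the cubes over
  \<open>A\<close> would have to vanish by themselves, although \<open>A\<close> is odd and hence
  nonempty.\<close>

lemma no_certificate_degree_0:
  assumes sg: "simple_graph n E" and cert: "nullstellensatz_certificate n (bayer_system n E) \<alpha>"
  shows "certificate_degree (bayer_system n E) (\<alpha> :: bit mpoly \<Rightarrow> bit mpoly) \<noteq> 0"
proof
  assume "certificate_degree (bayer_system n E) \<alpha> = 0"
  then have deg: "total_degree (\<alpha> f) \<le> 0" if "f \<in> bayer_system n E" for f
    using certificate_degree_le[OF finite_bayer_system[OF sg] cert, of 0] that by simp
  then have lin: "\<forall>f\<in>bayer_system n E. \<alpha> f \<in> lin n"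
    using cert by (force simp: nullstellensatz_certificate_def lin_def)
  have const: "coef (\<alpha> f) {#k#} \<noteq> 1" if "f \<in> bayer_system n E" for f k
  proof
    assume "coef (\<alpha> f) {#k#} = 1"
    then have "expo {#k#} \<in> Poly_Mapping.keys (\<alpha> f)"
      by (simp add: coef_def in_keys_iff)
    then have "monom_degree (expo {#k#}) \<le> 0"
      using deg[OF that] unfolding total_degree_le_iff by blast
    then show False by (simp add: monom_degree_expo)
  qed
  obtain A B where A: "A \<subseteq> {1..n}" "odd (card A)" and "B \<subseteq> E \<times> {1..n}"
    and zero: "\<forall>M. size M = 3 \<longrightarrow>
       coef ((\<Sum>i\<in>A. mon {#i, i, i#}) + (\<Sum>(e, k)\<in>B. mon {#k#} * edge_poly e)) M = 0"
    and B: "\<forall>(e, k)\<in>B. \<exists>f\<in>bayer_system n E. coef (\<alpha> f) {#k#} = 1"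
    by (rule linear_certificateE[OF sg cert lin])
  from B const have "B = {}" by fast
  from A(2) obtain i where i: "i \<in> A" by (metis card.empty even_zero ex_in_conv)
  have "finite A" using A(1) by (rule finite_subset) simp
  then have "(\<Sum>j\<in>A. coef (mon {#j, j, j#}) {#i, i, i#}) = 1"
    using i by (simp add: coef_mon mset_square_eq_iff of_bool_def)
  then show False
    using zero[rule_format, of "{#i, i, i#}"] \<open>B = {}\<close> by (simp add: coef_sum)
qed

theorem theorem1p6:
  fixes n :: nat and E :: "nat set set"
  assumes "simple_graph n E"
  shows "nullstellensatz_number TYPE(bit) n E = 1 \<longleftrightarrow> covered_by_length2_paths n E"
proof
  let ?F = "bayer_system n E :: bit mpoly set"
  let ?D = "{enat (certificate_degree ?F \<alpha>) | \<alpha>. nullstellensatz_certificate n ?F \<alpha>}"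
  note fin = finite_bayer_system[OF assms]
  have N: "nullstellensatz_number TYPE(bit) n E = Inf ?D"
    by (simp add: nullstellensatz_number_def)
  {
    assume "nullstellensatz_number TYPE(bit) n E = 1"
    with N have Inf: "Inf ?D = 1" by simp
    \<comment> \<open>The infimum of the empty set is infinite, so a certificate exists; over
      \<open>enat\<close> the infimum of a nonempty set is attained, here by a certificate of degree
      exactly 1.\<close>
    then have "?D \<noteq> {}" by (auto simp: Inf_enat_def one_enat_def split: if_splits)
    then obtain d where "d \<in> ?D" by blast
    then have "(LEAST d. d \<in> ?D) \<in> ?D" by (rule LeastI)
    then have "Inf ?D \<in> ?D" using \<open>?D \<noteq> {}\<close> unfolding Inf_enat_def by (simp only: if_False)
    then obtain \<alpha> where \<alpha>: "nullstellensatz_certificate n ?F \<alpha>" "certificate_degree ?F \<alpha> = 1"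
      unfolding Inf by (auto simp: one_enat_def)
    then have lin: "\<forall>f\<in>?F. \<alpha> f \<in> lin n"
      using certificate_degree_le[OF fin \<alpha>(1), of 1]
      by (auto simp: lin_def nullstellensatz_certificate_def)
    show "covered_by_length2_paths n E"
    proof (rule linear_certificateE[OF assms \<alpha>(1) lin])
      fix A B
      assume A: "A \<subseteq> {1..n}" "odd (card A)" and B: "B \<subseteq> E \<times> {1..n}"
        "\<forall>M. size M = 3 \<longrightarrow>
           coef ((\<Sum>i\<in>A. mon {#i, i, i#}) + (\<Sum>(e, k)\<in>B. mon {#k#} * edge_poly e)) M = 0"
      show ?thesis
        by (rule linear_certificate_pathsE[OF assms B])
          (rule covered_of_path_decomposition[OF assms A])
    qed
  }
  {
    assume "covered_by_length2_paths n E"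
    then have "1 \<in> lspan n ?F" using assms by (intro one_in_lspan)
    then obtain \<alpha> where \<alpha>: "1 = (\<Sum>f\<in>?F. \<alpha> f * f)" "\<forall>f\<in>?F. \<alpha> f \<in> lin n"
      unfolding lspan_def by blast
    then have cert: "nullstellensatz_certificate n ?F \<alpha>"
      by (auto simp: nullstellensatz_certificate_def lin_def)
    then have "certificate_degree ?F \<alpha> \<le> 1"
      using certificate_degree_le[OF fin cert, of 1] \<alpha>(2) by (simp add: lin_def)
    then have "Inf ?D \<le> 1"
      using cert by (intro Inf_lower2[of "enat (certificate_degree ?F \<alpha>)"]) (auto simp: one_enat_def)
    moreover have "1 \<le> Inf ?D"
    proof (rule Inf_greatest)
      fix d assume "d \<in> ?D"
      then obtain \<beta> where "nullstellensatz_certificate n ?F \<beta>" "d = enat (certificate_degree ?F \<beta>)"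
        by blast
      with no_certificate_degree_0[OF assms this(1)] show "1 \<le> d"
        by (simp add: one_enat_def)
    qed
    ultimately show "nullstellensatz_number TYPE(bit) n E = 1" by (simp add: N)
  }
qed

end
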